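(* Let $L$ be an arbitrary countable language and let $\mathcal{M}$ be a countable infinite $L$-structure. If there is an invariant probability measure $\mu$ on $S_L$ that is concentrated on $\mathcal{M}$, then $\mathcal{M}$ has trivial definable closure.
   Context: $L$ may contain relation, constant and function symbols. $S_L$ is the set of $L$-structures with underlying set $\mathbb{N}$ with the Borel $\sigma$-algebra generated by the sets $\{\mathcal{N}: R^{\mathcal{N}}(n_1,\dots,n_j)\}$, $\{\mathcal{N}: c^{\mathcal{N}}=\ell\}$, $\{\mathcal{N}: f^{\mathcal{N}}(n_1,\dots,n_k)=\ell\}$. Invariant means invariant under the logic action of $\mathrm{Sym}(\mathbb{N})$ (induced by permuting $\mathbb{N}$); concentrated on $\mathcal{M}$ means giving measure $1$ to the set of structures in $S_L$ isomorphic to $\mathcal{M}$. $\mathcal{M}$ has trivial definable closure if for every finite tuple $\mathbf{a}$ in $\mathcal{M}$, the elements fixed by all automorphisms of $\mathcal{M}$ fixing $\mathbf{a}$ pointwise are exactly the entries of $\mathbf{a}$. *)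

theory Defs
  imports "HOL-Probability.Probability"
begin

record ('r, 'c, 'f) language =
  rel_syms :: "'r set"
  const_syms :: "'c set"
  fun_syms :: "'f set"
  rel_arity :: "'r \<Rightarrow> nat"
  fun_arity :: "'f \<Rightarrow> nat"

definition countable_language :: "('r, 'c, 'f) language \<Rightarrow> bool" where
  "countable_language L \<longleftrightarrow>
     countable (rel_syms L) \<and> countable (const_syms L) \<and> countable (fun_syms L)"

record ('a, 'r, 'c, 'f) lstructure =
  universe :: "'a set"
  rel_int :: "'r \<Rightarrow> 'a list set"
  const_int :: "'c \<Rightarrow> 'a"
  fun_int :: "'f \<Rightarrow> 'a list \<Rightarrow> 'a"

definition tuples :: "'a set \<Rightarrow> nat \<Rightarrow> 'a list set" where
  "tuples A n = {xs. length xs = n \<and> set xs \<subseteq> A}"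

text \<open>Interpretations are \<^const>\<open>undefined\<close> outside the symbols of the language and outside the
  tuples of the right length over the universe. So two structures are equal as records iff they have
  the same universe and interpret every symbol in the same way.\<close>

definition is_structure ::
    "('r, 'c, 'f) language \<Rightarrow> ('a, 'r, 'c, 'f) lstructure \<Rightarrow> bool" where
  "is_structure L M \<longleftrightarrow>
     rel_int M \<in> (\<Pi>\<^sub>E R\<in>rel_syms L. Pow (tuples (universe M) (rel_arity L R))) \<and>
     const_int M \<in> const_syms L \<rightarrow>\<^sub>E universe M \<and>
     fun_int M \<in> (\<Pi>\<^sub>E f\<in>fun_syms L. tuples (universe M) (fun_arity L f) \<rightarrow>\<^sub>E universe M)"

text \<open>Only the values of \<open>h\<close> on the universe of \<open>M\<close> matter.\<close>

definition isomorphism ::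
    "('r, 'c, 'f) language \<Rightarrow> ('a, 'r, 'c, 'f) lstructure \<Rightarrow> ('b, 'r, 'c, 'f) lstructure
      \<Rightarrow> ('a \<Rightarrow> 'b) \<Rightarrow> bool" where
  "isomorphism L M N h \<longleftrightarrow>
     bij_betw h (universe M) (universe N) \<and>
     (\<forall>R\<in>rel_syms L. \<forall>xs\<in>tuples (universe M) (rel_arity L R).
        xs \<in> rel_int M R \<longleftrightarrow> map h xs \<in> rel_int N R) \<and>
     (\<forall>c\<in>const_syms L. h (const_int M c) = const_int N c) \<and>
     (\<forall>f\<in>fun_syms L. \<forall>xs\<in>tuples (universe M) (fun_arity L f).
        h (fun_int M f xs) = fun_int N f (map h xs))"

definition isomorphic ::
    "('r, 'c, 'f) language \<Rightarrow> ('a, 'r, 'c, 'f) lstructure \<Rightarrow> ('b, 'r, 'c, 'f) lstructure \<Rightarrow> bool" where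
  "isomorphic L M N \<longleftrightarrow> (\<exists>h. isomorphism L M N h)"

definition automorphism ::
    "('r, 'c, 'f) language \<Rightarrow> ('a, 'r, 'c, 'f) lstructure \<Rightarrow> ('a \<Rightarrow> 'a) \<Rightarrow> bool" where
  "automorphism L M h \<longleftrightarrow> isomorphism L M M h"

definition dcl ::
    "('r, 'c, 'f) language \<Rightarrow> ('a, 'r, 'c, 'f) lstructure \<Rightarrow> 'a list \<Rightarrow> 'a set" where
  "dcl L M a =
     {b \<in> universe M. \<forall>h. automorphism L M h \<and> (\<forall>x\<in>set a. h x = x) \<longrightarrow> h b = b}"

definition trivial_dcl ::
    "('r, 'c, 'f) language \<Rightarrow> ('a, 'r, 'c, 'f) lstructure \<Rightarrow> bool" where
  "trivial_dcl L M \<longleftrightarrow> (\<forall>a. set a \<subseteq> universe M \<longrightarrow> dcl L M a = set a)"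

definition nat_structures :: "('r, 'c, 'f) language \<Rightarrow> (nat, 'r, 'c, 'f) lstructure set" where
  "nat_structures L = {N. is_structure L N \<and> universe N = UNIV}"

definition structure_space :: "('r, 'c, 'f) language \<Rightarrow> (nat, 'r, 'c, 'f) lstructure measure" where
  "structure_space L = sigma (nat_structures L)
     ({{N \<in> nat_structures L. ns \<in> rel_int N R} | R ns.
         R \<in> rel_syms L \<and> length ns = rel_arity L R} \<union>
      {{N \<in> nat_structures L. const_int N c = l} | c l. c \<in> const_syms L} \<union>
      {{N \<in> nat_structures L. fun_int N f ns = l} | f ns l.
         f \<in> fun_syms L \<and> length ns = fun_arity L f})"

definition logic_action ::
    "('r, 'c, 'f) language \<Rightarrow> (nat \<Rightarrow> nat) \<Rightarrow> (nat, 'r, 'c, 'f) lstructure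
      \<Rightarrow> (nat, 'r, 'c, 'f) lstructure" where
  "logic_action L g N =
     \<lparr>universe = UNIV,
      rel_int = (\<lambda>R\<in>rel_syms L. {ns. map (inv g) ns \<in> rel_int N R}),
      const_int = (\<lambda>c\<in>const_syms L. g (const_int N c)),
      fun_int = (\<lambda>f\<in>fun_syms L. \<lambda>ns\<in>tuples UNIV (fun_arity L f).
        g (fun_int N f (map (inv g) ns)))\<rparr>"

definition invariant_measure ::
    "('r, 'c, 'f) language \<Rightarrow> (nat, 'r, 'c, 'f) lstructure measure \<Rightarrow> bool" where
  "invariant_measure L \<mu> \<longleftrightarrow>
     (\<forall>g. bij g \<longrightarrow> (\<forall>B\<in>sets \<mu>. emeasure \<mu> (logic_action L g ` B) = emeasure \<mu> B))"

text \<open>The isomorphism class is Borel by Scott's theorem, so \<^const>\<open>emeasure\<close> being \<open>0\<close> on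
  non-measurable sets plays no role here.\<close>

definition concentrated_on ::
    "('r, 'c, 'f) language \<Rightarrow> (nat, 'r, 'c, 'f) lstructure measure
      \<Rightarrow> ('a, 'r, 'c, 'f) lstructure \<Rightarrow> bool" where
  "concentrated_on L \<mu> M \<longleftrightarrow> emeasure \<mu> {N \<in> nat_structures L. isomorphic L N M} = 1"

end

theory Submission
  imports Defs
begin

text \<open>Call a family of Borel sets of structures on \<open>\<nat>\<close>, indexed by tuples of natural numbers, an
  invariant family if it is equivariant under \<open>Sym(\<nat>)\<close>; such families play the role of
  \<open>L\<^bsub>\<omega>\<^sub>1\<omega>\<^esub>\<close>-formulas. Since they are closed under countable intersections and existential
  quantification, the relation ``no invariant family separates \<open>u\<close> from \<open>v\<close> in \<open>N\<close>'' has the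
  back-and-forth property, so it is the orbit equivalence of the automorphism group of \<open>N\<close>.
  Hence, inside the isomorphism class of \<open>N\<close>, having the type of a given tuple is a Borel
  condition. If \<open>b\<close> is in the definable closure of \<open>a\<close> but not in \<open>a\<close>, then for some tuple \<open>m\<close>
  the events ``\<open>(m, n)\<close> has the type of \<open>(a, b)\<close>'', with \<open>n\<close> ranging over the numbers outside
  \<open>m\<close>, are disjoint and, by invariance, have the same positive probability.\<close>

section \<open>The logic action\<close>

lemma tuples_UNIV: "tuples UNIV n = {xs. length xs = n}"
  by (auto simp: tuples_def)

lemma map_inv_map:
  assumes "bij g"
  shows "map (inv g) (map g xs) = xs" "map g (map (inv g) ys) = ys"
  using assms by (auto simp: bij_is_inj bij_is_surj surj_f_inv_f intro!: map_idI)

lemma nat_structures_iff: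
  "N \<in> nat_structures L \<longleftrightarrow>
     universe N = UNIV \<and>
     rel_int N \<in> (\<Pi>\<^sub>E R\<in>rel_syms L. Pow {xs. length xs = rel_arity L R}) \<and>
     const_int N \<in> const_syms L \<rightarrow>\<^sub>E UNIV \<and>
     fun_int N \<in> (\<Pi>\<^sub>E f\<in>fun_syms L. {xs. length xs = fun_arity L f} \<rightarrow>\<^sub>E UNIV)"
proof -
  have "is_structure L N \<longleftrightarrow>
     rel_int N \<in> (\<Pi>\<^sub>E R\<in>rel_syms L. Pow {xs. length xs = rel_arity L R}) \<and>
     const_int N \<in> const_syms L \<rightarrow>\<^sub>E UNIV \<and>
     fun_int N \<in> (\<Pi>\<^sub>E f\<in>fun_syms L. {xs. length xs = fun_arity L f} \<rightarrow>\<^sub>E UNIV)"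
    if "universe N = UNIV"
    unfolding is_structure_def that tuples_UNIV ..
  then show ?thesis
    unfolding nat_structures_def mem_Collect_eq by metis
qed

lemma logic_action_in_nat_structures:
  assumes "N \<in> nat_structures L"
  shows "logic_action L g N \<in> nat_structures L"
proof -
  have "length ns = rel_arity L R"
    if "R \<in> rel_syms L" "map (inv g) ns \<in> rel_int N R" for R ns
    using that assms unfolding nat_structures_iff by fastforce
  then show ?thesis
    unfolding nat_structures_iff logic_action_def by (auto simp: tuples_UNIV)
qed

text \<open>Structures in \<open>nat_structures L\<close> are extensional, so they are equal as soon
  as they agree on the symbols of the language and on tuples of the right length. Substituting
  \<open>map g xs\<close> for the arguments turns each equation into a preservation clause.
  Statements on isomorphisms thereby become equations for the action.\<close>

lemma isomorphism_iff_logic_action: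
  assumes N: "N \<in> nat_structures L" and N': "N' \<in> nat_structures L"
  shows "isomorphism L N N' g \<longleftrightarrow> bij g \<and> logic_action L g N = N'"
proof (cases "bij g")
  case False
  then show ?thesis
    using N N' by (simp add: isomorphism_def nat_structures_iff)
next
  case g: True
  let ?A = "logic_action L g N"
  have A: "?A \<in> nat_structures L"
    using N by (rule logic_action_in_nat_structures)
  have rel: "rel_int ?A = rel_int N' \<longleftrightarrow>
      (\<forall>R\<in>rel_syms L. \<forall>xs. length xs = rel_arity L R \<longrightarrow>
        (xs \<in> rel_int N R \<longleftrightarrow> map g xs \<in> rel_int N' R))" (is "?l \<longleftrightarrow> ?r")
  proof
    assume ?l
    then show ?r
      using g by (auto simp: logic_action_def map_inv_map simp flip: \<open>?l\<close> simp del: map_map)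
  next
    assume r: ?r
    show ?l
    proof (rule PiE_ext)
      show "rel_int ?A \<in> (\<Pi>\<^sub>E R\<in>rel_syms L. Pow {xs. length xs = rel_arity L R})"
        "rel_int N' \<in> (\<Pi>\<^sub>E R\<in>rel_syms L. Pow {xs. length xs = rel_arity L R})"
        using A N' by (simp_all add: nat_structures_iff)
      fix R assume R: "R \<in> rel_syms L"
      have len: "rel_int N R \<subseteq> {xs. length xs = rel_arity L R}"
        "rel_int N' R \<subseteq> {xs. length xs = rel_arity L R}"
        using N N' R by (auto simp: nat_structures_iff PiE_iff)
      \<comment> \<open>A list of the wrong length lies in neither side, since both interpretations
        contain only tuples of the right arity.\<close>
      have "map (inv g) xs \<in> rel_int N R \<longleftrightarrow> xs \<in> rel_int N' R" for xs
      proof (cases "length xs = rel_arity L R")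
        case True
        then show ?thesis
          using r R map_inv_map(2)[OF g] by (metis length_map)
      next
        case False
        then show ?thesis using len by (metis (mono_tags) length_map mem_Collect_eq subsetD)
      qed
      then show "rel_int ?A R = rel_int N' R"
        using R by (auto simp: logic_action_def)
    qed
  qed
  have const: "const_int ?A = const_int N' \<longleftrightarrow>
      (\<forall>c\<in>const_syms L. g (const_int N c) = const_int N' c)" (is "?l \<longleftrightarrow> ?r")
  proof
    assume ?l
    then show ?r by (auto simp: logic_action_def simp flip: \<open>?l\<close>)
  next
    assume r: ?r
    show ?l
      by (rule PiE_ext[of _ "const_syms L" "\<lambda>_. UNIV"])
        (use A N' r in \<open>auto simp: nat_structures_iff logic_action_def\<close>)
  qed
  have func: "fun_int ?A = fun_int N' \<longleftrightarrow>
      (\<forall>f\<in>fun_syms L. \<forall>xs. length xs = fun_arity L f \<longrightarrow>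
        g (fun_int N f xs) = fun_int N' f (map g xs))" (is "?l \<longleftrightarrow> ?r")
  proof
    assume ?l
    then show ?r
      using g by (auto simp: logic_action_def tuples_UNIV map_inv_map
          simp flip: \<open>?l\<close> simp del: map_map)
  next
    assume r: ?r
    show ?l
    proof (rule PiE_ext)
      show "fun_int ?A \<in> (\<Pi>\<^sub>E f\<in>fun_syms L. {xs. length xs = fun_arity L f} \<rightarrow>\<^sub>E UNIV)"
        "fun_int N' \<in> (\<Pi>\<^sub>E f\<in>fun_syms L. {xs. length xs = fun_arity L f} \<rightarrow>\<^sub>E UNIV)"
        using A N' by (simp_all add: nat_structures_iff)
      fix f assume f: "f \<in> fun_syms L"
      show "fun_int ?A f = fun_int N' f"
      proof (rule PiE_ext)
        show "fun_int ?A f \<in> {xs. length xs = fun_arity L f} \<rightarrow>\<^sub>E UNIV"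
          "fun_int N' f \<in> {xs. length xs = fun_arity L f} \<rightarrow>\<^sub>E UNIV"
          using A N' f by (auto simp: nat_structures_iff PiE_iff)
        fix xs :: "nat list" assume "xs \<in> {xs. length xs = fun_arity L f}"
        moreover from this have "g (fun_int N f (map (inv g) xs)) = fun_int N' f xs"
          using r f map_inv_map(2)[OF g] by simp
        ultimately show "fun_int ?A f xs = fun_int N' f xs"
          using f by (simp add: logic_action_def tuples_UNIV)
      qed
    qed
  qed
  have univ: "universe ?A = UNIV" "universe N = UNIV" "universe N' = UNIV"
    using A N N' by (simp_all add: nat_structures_iff)
  have "?A = N' \<longleftrightarrow>
      rel_int ?A = rel_int N' \<and> const_int ?A = const_int N' \<and> fun_int ?A = fun_int N'"
    using univ by (auto intro: lstructure.equality)
  then show ?thesis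
    unfolding isomorphism_def univ tuples_UNIV rel const func
    using g by auto
qed

section \<open>Composition and inversion of isomorphisms\<close>

lemma isomorphism_comp:
  assumes "isomorphism L A B h" and "isomorphism L B C k"
  shows "isomorphism L A C (k \<circ> h)"
proof -
  have "map h xs \<in> tuples (universe B) n" if "xs \<in> tuples (universe A) n" for xs n
    using that assms(1) by (auto simp: tuples_def isomorphism_def bij_betw_def)
  with assms show ?thesis
    unfolding isomorphism_def by (auto intro: bij_betw_trans)
qed

text \<open>Each clause for the inverse is the clause for \<open>h\<close> read backwards: by
  \<open>lift\<close>, a tuple over the universe of \<open>B\<close> is the image of one over that
  of \<open>A\<close>. That \<open>A\<close> is a structure puts constants and function values into
  its universe, where \<open>inv_into\<close> undoes \<open>h\<close>.\<close>

lemma isomorphism_inv_into: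
  assumes A: "is_structure L A" and h: "isomorphism L A B h"
  shows "isomorphism L B A (inv_into (universe A) h)"
proof -
  let ?k = "inv_into (universe A) h"
  have bij: "bij_betw h (universe A) (universe B)"
    using h by (simp add: isomorphism_def)
  have k: "?k (h x) = x" if "x \<in> universe A" for x
    using that bij by (simp add: bij_betw_inv_into_left)
  have lift: "\<exists>ys. ys \<in> tuples (universe A) n \<and> xs = map h ys \<and> map ?k xs = ys"
    if "xs \<in> tuples (universe B) n" for xs n
  proof (intro exI conjI)
    show "map ?k xs \<in> tuples (universe A) n"
      using that bij_betw_inv_into[OF bij] by (auto simp: tuples_def bij_betw_def)
    show "xs = map h (map ?k xs)"
      using that bij by (auto simp: tuples_def bij_betw_inv_into_right intro!: map_idI[symmetric])
  qed simp
  have c: "const_int A c \<in> universe A" if "c \<in> const_syms L" for c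
    using A that by (auto simp: is_structure_def PiE_iff)
  have f: "fun_int A f xs \<in> universe A"
    if "f \<in> fun_syms L" "xs \<in> tuples (universe A) (fun_arity L f)" for f xs
    using A that by (auto simp: is_structure_def PiE_iff)
  show ?thesis
    unfolding isomorphism_def
  proof (intro conjI ballI)
    show "bij_betw ?k (universe B) (universe A)"
      using bij by (rule bij_betw_inv_into)
  next
    fix R xs assume R: "R \<in> rel_syms L" and xs: "xs \<in> tuples (universe B) (rel_arity L R)"
    from lift[OF xs] obtain ys where
      "ys \<in> tuples (universe A) (rel_arity L R)" "xs = map h ys" "map ?k xs = ys"
      by blast
    then show "xs \<in> rel_int B R \<longleftrightarrow> map ?k xs \<in> rel_int A R"
      using R h by (simp add: isomorphism_def del: map_map)
  next
    fix d assume d: "d \<in> const_syms L"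
    then have "const_int B d = h (const_int A d)"
      using h by (simp add: isomorphism_def)
    then show "?k (const_int B d) = const_int A d"
      using k[OF c[OF d]] by simp
  next
    fix F xs assume F: "F \<in> fun_syms L" and xs: "xs \<in> tuples (universe B) (fun_arity L F)"
    from lift[OF xs] obtain ys where
      ys: "ys \<in> tuples (universe A) (fun_arity L F)" "xs = map h ys" "map ?k xs = ys"
      by blast
    then have "fun_int B F xs = h (fun_int A F ys)"
      using F h by (simp add: isomorphism_def)
    then show "?k (fun_int B F xs) = fun_int A F (map ?k xs)"
      using k[OF f[OF F ys(1)]] ys(3) by simp
  qed
qed

lemma logic_action_inv:
  assumes N: "N \<in> nat_structures L" and g: "bij g"
  shows "logic_action L (inv g) (logic_action L g N) = N"
proof -
  have A: "logic_action L g N \<in> nat_structures L"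
    using N by (rule logic_action_in_nat_structures)
  have "isomorphism L N (logic_action L g N) g"
    using N A g by (simp add: isomorphism_iff_logic_action)
  then have "isomorphism L (logic_action L g N) N (inv g)"
    using isomorphism_inv_into[of L N _ g] N by (simp add: nat_structures_def)
  then show ?thesis
    using N A by (simp add: isomorphism_iff_logic_action)
qed

section \<open>Invariant families\<close>

lemma space_structure_space: "space (structure_space L) = nat_structures L"
  unfolding structure_space_def by (rule space_measure_of) auto

lemma sets_structure_space:
  "sets (structure_space L) = sigma_sets (nat_structures L)
     ({{N \<in> nat_structures L. ns \<in> rel_int N R} | R ns.
         R \<in> rel_syms L \<and> length ns = rel_arity L R} \<union>
      {{N \<in> nat_structures L. const_int N c = l} | c l. c \<in> const_syms L} \<union>
      {{N \<in> nat_structures L. fun_int N f ns = l} | f ns l.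
         f \<in> fun_syms L \<and> length ns = fun_arity L f})"
  unfolding structure_space_def by (rule sets_measure_of) auto

text \<open>\<open>P w\<close> is to be read as the set of structures in which the tuple
  \<open>w\<close> satisfies the formula \<open>P\<close>. The length of \<open>w\<close> is left
  open, so a family may depend on it.\<close>

definition invariant_family ::
    "('r, 'c, 'f) language \<Rightarrow> (nat list \<Rightarrow> (nat, 'r, 'c, 'f) lstructure set) \<Rightarrow> bool" where
  "invariant_family L P \<longleftrightarrow>
     (\<forall>w. P w \<in> sets (structure_space L)) \<and>
     (\<forall>g w. bij g \<longrightarrow> (\<forall>N\<in>nat_structures L. logic_action L g N \<in> P (map g w) \<longleftrightarrow> N \<in> P w))"

lemma invariant_familyI:
  assumes "\<And>w. P w \<in> sets (structure_space L)"
    and "\<And>g w N. bij g \<Longrightarrow> N \<in> nat_structures L \<Longrightarrow>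
           logic_action L g N \<in> nat_structures L \<Longrightarrow>
           logic_action L g N \<in> P (map g w) \<longleftrightarrow> N \<in> P w"
  shows "invariant_family L P"
  using assms logic_action_in_nat_structures unfolding invariant_family_def by blast

lemma invariant_family_sets: "invariant_family L P \<Longrightarrow> P w \<in> sets (structure_space L)"
  by (simp add: invariant_family_def)

lemma invariant_family_subset: "invariant_family L P \<Longrightarrow> P w \<subseteq> nat_structures L"
  using invariant_family_sets sets.sets_into_space space_structure_space by metis

lemma invariant_family_iff:
  "invariant_family L P \<Longrightarrow> bij g \<Longrightarrow> N \<in> nat_structures L \<Longrightarrow>
     logic_action L g N \<in> P (map g w) \<longleftrightarrow> N \<in> P w"
  by (simp add: invariant_family_def)

text \<open>Invariance of a measure is stated with images under the action, and this lemma brings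
  equivariance into that form. The harder inclusion pulls \<open>N\<close> back by
  \<open>inv g\<close>.\<close>

lemma invariant_family_image:
  assumes P: "invariant_family L P" and g: "bij g"
  shows "logic_action L g ` P w = P (map g w)"
proof (intro equalityI subsetI)
  fix N assume "N \<in> logic_action L g ` P w"
  then show "N \<in> P (map g w)"
    using invariant_family_iff[OF P g] invariant_family_subset[OF P] by blast
next
  fix N assume N: "N \<in> P (map g w)"
  then have X: "N \<in> nat_structures L"
    using invariant_family_subset[OF P] by blast
  let ?K = "logic_action L (inv g) N"
  have "logic_action L g ?K = N"
    using logic_action_inv[OF X bij_imp_bij_inv[OF g]] g by (simp add: inv_inv_eq)
  moreover have "?K \<in> P w"
    using invariant_family_iff[OF P bij_imp_bij_inv[OF g] X, of "map g w"] N map_inv_map[OF g]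
    by (simp del: map_map)
  ultimately show "N \<in> logic_action L g ` P w"
    by (metis imageI)
qed

section \<open>Difference, countable intersection and existential quantification\<close>

lemma invariant_family_Diff:
  assumes "invariant_family L P" and "invariant_family L Q"
  shows "invariant_family L (\<lambda>w. P w - Q w)"
  using assms by (intro invariant_familyI) (auto simp: invariant_family_sets invariant_family_iff)

text \<open>The factor \<open>nat_structures L\<close> gives the right value for empty
  \<open>I\<close>, where the bare intersection would be the whole type.\<close>

lemma invariant_family_INT:
  assumes "countable I" and "\<And>i. i \<in> I \<Longrightarrow> invariant_family L (P i)"
  shows "invariant_family L (\<lambda>w. nat_structures L \<inter> (\<Inter>i\<in>I. P i w))"
proof (rule invariant_familyI)
  fix w
  have "nat_structures L \<inter> (\<Inter>i\<in>I. P i w) = (\<Inter>i\<in>I. P i w) \<inter> space (structure_space L)"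
    by (auto simp: space_structure_space)
  also have "\<dots> \<in> sets (structure_space L)"
    using assms by (cases "I = {}") (auto intro!: sets.Int sets.countable_INT'
        simp: invariant_family_sets)
  finally show "nat_structures L \<inter> (\<Inter>i\<in>I. P i w) \<in> sets (structure_space L)" .
qed (use assms(2) invariant_family_iff in \<open>fastforce\<close>)

text \<open>The witness ranges over the countable set of natural numbers, so the union stays Borel.
  Since \<open>g\<close> is onto, the union over \<open>y\<close> may be reindexed as one over
  \<open>g y\<close>.\<close>

lemma invariant_family_exists:
  assumes P: "invariant_family L P"
  shows "invariant_family L (\<lambda>w. \<Union>y. P (w @ [y]))"
proof (rule invariant_familyI)
  fix w show "(\<Union>y. P (w @ [y])) \<in> sets (structure_space L)"
    using invariant_family_sets[OF P] by auto
next
  fix g :: "nat \<Rightarrow> nat" and w N assume g: "bij g" and N: "N \<in> nat_structures L"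
  have "logic_action L g N \<in> P (map g w @ [g y]) \<longleftrightarrow> N \<in> P (w @ [y])" for y
    using invariant_family_iff[OF P g N, of "w @ [y]"] by simp
  moreover have "(\<Union>y. P (map g w @ [y])) = (\<Union>y. P (map g w @ [g y]))"
  proof -
    have "(\<Union>y. P (map g w @ [y])) = (\<Union>y\<in>range g. P (map g w @ [y]))"
      by (simp only: bij_is_surj[OF g])
    then show ?thesis by (simp add: image_image)
  qed
  ultimately show "logic_action L g N \<in> (\<Union>y. P (map g w @ [y])) \<longleftrightarrow> N \<in> (\<Union>y. P (w @ [y]))"
    by blast
qed

text \<open>Atomic conditions name entries of \<open>w\<close> by position, and
  \<open>map g w ! i\<close> is known to be \<open>g (w ! i)\<close> only below the length. The
  guard makes such a family empty where \<open>w\<close> is too short.\<close>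

lemma invariant_family_guard:
  assumes "\<And>g w. bij g \<Longrightarrow> p (map g w) \<longleftrightarrow> p w"
    and "\<And>w. p w \<Longrightarrow> P w \<in> sets (structure_space L)"
    and "\<And>g w N. p w \<Longrightarrow> bij g \<Longrightarrow> N \<in> nat_structures L \<Longrightarrow>
           logic_action L g N \<in> nat_structures L \<Longrightarrow>
           logic_action L g N \<in> P (map g w) \<longleftrightarrow> N \<in> P w"
  shows "invariant_family L (\<lambda>w. if p w then P w else {})"
  using assms by (intro invariant_familyI) auto

section \<open>Families given by atomic formulas\<close>

lemma invariant_family_top: "invariant_family L (\<lambda>_. nat_structures L)"
  using sets.top[of "structure_space L"]
  by (intro invariant_familyI) (simp_all add: space_structure_space)

lemma invariant_family_eq:
  "invariant_family L
     (\<lambda>w. if i < length w \<and> j < length w \<and> w ! i = w ! j then nat_structures L else {})"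
  using invariant_family_sets[OF invariant_family_top]
  by (intro invariant_family_guard) (auto simp: bij_def inj_eq)

text \<open>The list \<open>is\<close> holds the positions of the variables in the atomic formula.
  The action evaluates \<open>R\<close> at arguments pulled back by \<open>inv g\<close>, which
  cancels the \<open>g\<close> applied to \<open>w\<close>.\<close>

lemma invariant_family_rel:
  fixes L :: "('r, 'c, 'f) language"
  assumes "R \<in> rel_syms L" and "length is = rel_arity L R"
  shows "invariant_family L (\<lambda>w. if \<forall>i\<in>set is. i < length w
     then {N \<in> nat_structures L. map ((!) w) is \<in> rel_int N R} else {})"
proof (rule invariant_family_guard)
  fix w :: "nat list"
  show "{N \<in> nat_structures L. map ((!) w) is \<in> rel_int N R} \<in> sets (structure_space L)"
    unfolding sets_structure_space
    by (rule sigma_sets.Basic, intro UnI1 CollectI exI[of _ R] exI[of _ "map ((!) w) is"])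
      (use assms in auto)
next
  fix g :: "nat \<Rightarrow> nat" and w :: "nat list" and N :: "(nat, 'r, 'c, 'f) lstructure"
  assume w: "\<forall>i\<in>set is. i < length w" and g: "bij g"
  have "map ((!) (map g w)) is = map g (map ((!) w) is)"
    using w by auto
  then have "map (inv g) (map ((!) (map g w)) is) = map ((!) w) is"
    using map_inv_map(1)[OF g] by metis
  moreover assume "N \<in> nat_structures L" "logic_action L g N \<in> nat_structures L"
  ultimately show "logic_action L g N \<in>
        {N \<in> nat_structures L. map ((!) (map g w)) is \<in> rel_int N R} \<longleftrightarrow>
      N \<in> {N \<in> nat_structures L. map ((!) w) is \<in> rel_int N R}"
    using assms(1) by (simp add: logic_action_def del: map_map)
qed auto

lemma invariant_family_const:
  fixes L :: "('r, 'c, 'f) language"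
  assumes "c \<in> const_syms L"
  shows "invariant_family L (\<lambda>w. if j < length w
     then {N \<in> nat_structures L. const_int N c = w ! j} else {})"
proof (rule invariant_family_guard)
  fix w :: "nat list"
  show "{N \<in> nat_structures L. const_int N c = w ! j} \<in> sets (structure_space L)"
    unfolding sets_structure_space
    by (rule sigma_sets.Basic, rule UnI1, rule UnI2) (use assms in auto)
next
  fix g :: "nat \<Rightarrow> nat" and w :: "nat list" and N :: "(nat, 'r, 'c, 'f) lstructure"
  assume "j < length w" and "bij g"
    and "N \<in> nat_structures L" "logic_action L g N \<in> nat_structures L"
  then show "logic_action L g N \<in> {N \<in> nat_structures L. const_int N c = map g w ! j} \<longleftrightarrow>
      N \<in> {N \<in> nat_structures L. const_int N c = w ! j}"
    using assms by (simp add: logic_action_def bij_def inj_eq)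
qed auto

lemma invariant_family_fun:
  fixes L :: "('r, 'c, 'f) language"
  assumes "f \<in> fun_syms L" and "length is = fun_arity L f"
  shows "invariant_family L (\<lambda>w. if j < length w \<and> (\<forall>i\<in>set is. i < length w)
     then {N \<in> nat_structures L. fun_int N f (map ((!) w) is) = w ! j} else {})"
proof (rule invariant_family_guard)
  fix w :: "nat list"
  show "{N \<in> nat_structures L. fun_int N f (map ((!) w) is) = w ! j} \<in> sets (structure_space L)"
    unfolding sets_structure_space
    by (rule sigma_sets.Basic, rule UnI2,
        intro CollectI exI[of _ f] exI[of _ "map ((!) w) is"] exI[of _ "w ! j"])
      (use assms in auto)
next
  fix g :: "nat \<Rightarrow> nat" and w :: "nat list" and N :: "(nat, 'r, 'c, 'f) lstructure"
  assume w: "j < length w \<and> (\<forall>i\<in>set is. i < length w)" and g: "bij g"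
  have "map ((!) (map g w)) is = map g (map ((!) w) is)"
    using w by auto
  then have "map (inv g) (map ((!) (map g w)) is) = map ((!) w) is"
    using map_inv_map(1)[OF g] by metis
  moreover assume "N \<in> nat_structures L" "logic_action L g N \<in> nat_structures L"
  ultimately show "logic_action L g N \<in>
        {N \<in> nat_structures L. fun_int N f (map ((!) (map g w)) is) = map g w ! j} \<longleftrightarrow>
      N \<in> {N \<in> nat_structures L. fun_int N f (map ((!) w) is) = w ! j}"
    using assms w g by (simp add: logic_action_def tuples_UNIV bij_def inj_eq del: map_map)
qed auto

section \<open>Inseparable tuples lie in the same orbit\<close>

definition inseparable ::
    "('r, 'c, 'f) language \<Rightarrow> (nat, 'r, 'c, 'f) lstructure \<Rightarrow> nat list \<Rightarrow> nat list \<Rightarrow> bool" where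
  "inseparable L N u v \<longleftrightarrow>
     length u = length v \<and> (\<forall>P. invariant_family L P \<longrightarrow> (N \<in> P u \<longleftrightarrow> N \<in> P v))"

lemma inseparable_sym: "inseparable L N u v \<Longrightarrow> inseparable L N v u"
  by (auto simp: inseparable_def)

lemma inseparable_iff:
  "inseparable L N u v \<Longrightarrow> invariant_family L P \<Longrightarrow> N \<in> P u \<longleftrightarrow> N \<in> P v"
  by (auto simp: inseparable_def)

text \<open>A family that separates in the wrong direction is replaced by its complement in
  \<open>nat_structures L\<close>.\<close>

lemma separating_family:
  assumes "N \<in> nat_structures L" and "length u = length v" and "\<not> inseparable L N u v"
  obtains P where "invariant_family L P" "N \<in> P u" "N \<notin> P v"
proof -
  from assms obtain P where P: "invariant_family L P" and ne: "N \<in> P u \<longleftrightarrow> N \<notin> P v"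
    unfolding inseparable_def by blast
  show thesis
  proof (cases "N \<in> P u")
    case True
    with P ne that show thesis by blast
  next
    case False
    with ne assms(1) show thesis
      by (intro that[OF invariant_family_Diff[OF invariant_family_top P]]) auto
  qed
qed

text \<open>If every \<open>d\<close> fails, choose for each \<open>d\<close> a family
  \<open>P d\<close> holding at \<open>u @ [c]\<close> but not at \<open>v @ [d]\<close>. The
  formula "some \<open>y\<close> satisfies all \<open>P d\<close>" is again an invariant family, as
  there are countably many \<open>d\<close>. It holds at \<open>u\<close> with witness
  \<open>c\<close>, and fails at \<open>v\<close> because \<open>y\<close> itself violates
  \<open>P y\<close>.\<close>

lemma inseparable_forth:
  assumes N: "N \<in> nat_structures L" and uv: "inseparable L N u v"
  shows "\<exists>d. inseparable L N (u @ [c]) (v @ [d])"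
proof (rule ccontr)
  assume no: "\<nexists>d. inseparable L N (u @ [c]) (v @ [d])"
  have "\<exists>P. invariant_family L P \<and> N \<in> P (u @ [c]) \<and> N \<notin> P (v @ [d])" for d
  proof -
    have "length (u @ [c]) = length (v @ [d])"
      using uv by (simp add: inseparable_def)
    with N no show ?thesis
      by (metis separating_family)
  qed
  then obtain P where P: "\<And>d. invariant_family L (P d)"
    and u: "\<And>d. N \<in> P d (u @ [c])" and v: "\<And>d. N \<notin> P d (v @ [d])"
    by metis
  let ?Q = "\<lambda>w. \<Union>y. nat_structures L \<inter> (\<Inter>d. P d (w @ [y]))"
  have "invariant_family L ?Q"
    using P by (intro invariant_family_exists invariant_family_INT) auto
  moreover have "N \<in> ?Q u"
    using N u by blast
  moreover have "N \<notin> ?Q v"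
    using v by blast
  ultimately show False
    using inseparable_iff[OF uv] by blast
qed

lemma inseparable_nth_eq:
  assumes "N \<in> nat_structures L" and "inseparable L N u v" and "i < length u" and "j < length u"
  shows "u ! i = u ! j \<longleftrightarrow> v ! i = v ! j"
  using inseparable_iff[OF assms(2) invariant_family_eq[of L i j]] assms
  by (auto simp: inseparable_def split: if_splits)

section \<open>The back-and-forth construction\<close>

text \<open>Stage \<open>n\<close> puts \<open>n\<close> into the left tuple and then into the right
  one, so that the limit map is total and onto. The conclusion also keeps related tuples covering
  every initial segment; atomic facts are later transferred along them.\<close>

lemma back_and_forth:
  fixes E :: "nat list \<Rightarrow> nat list \<Rightarrow> bool"
  assumes len: "\<And>u v. E u v \<Longrightarrow> length u = length v"
    and eq: "\<And>u v i j. E u v \<Longrightarrow> i < length u \<Longrightarrow> j < length u \<Longrightarrow> u ! i = u ! j \<longleftrightarrow> v ! i = v ! j"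
    and forw: "\<And>u v c. E u v \<Longrightarrow> \<exists>d. E (u @ [c]) (v @ [d])"
    and backw: "\<And>u v d. E u v \<Longrightarrow> \<exists>c. E (u @ [c]) (v @ [d])"
    and E: "E u v"
  shows "\<exists>g. bij g \<and> map g u = v \<and> (\<forall>n. \<exists>w. {..<n} \<subseteq> set w \<and> E w (map g w))"
proof -
  have "\<exists>c d. E (u @ [n, c]) (v @ [d, n])" if E: "E u v" for u v n
  proof -
    obtain d where "E (u @ [n]) (v @ [d])"
      using forw[OF E] by blast
    from backw[OF this, of n] show ?thesis
      by auto
  qed
  \<comment> \<open>Here \<open>p\<close> packs the current pair of tuples with the number
    \<open>n\<close> to be added, and \<open>x\<close> packs the two partners: \<open>fst x\<close>
    is the preimage of \<open>n\<close>, \<open>snd x\<close> its image.\<close>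
  then have "\<forall>p. \<exists>x. E (fst (fst p)) (snd (fst p)) \<longrightarrow>
      E (fst (fst p) @ [snd p, fst x]) (snd (fst p) @ [snd x, snd p])"
    by auto
  from choice[OF this] obtain e where
    e: "\<And>p. E (fst (fst p)) (snd (fst p)) \<Longrightarrow>
      E (fst (fst p) @ [snd p, fst (e p)]) (snd (fst p) @ [snd (e p), snd p])"
    by blast
  define s where
    "s = rec_nat (u, v) (\<lambda>n p. (fst p @ [n, fst (e (p, n))], snd p @ [snd (e (p, n)), n]))"
  define U V where "U n = fst (s n)" and "V n = snd (s n)" for n
  have 0: "U 0 = u" "V 0 = v"
    by (simp_all add: U_def V_def s_def)
  have US: "\<exists>x y. U (Suc n) = U n @ [n, x] \<and> V (Suc n) = V n @ [y, n]" for n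
    by (simp add: U_def V_def s_def)
  have EUV: "E (U n) (V n)" for n
  proof (induction n)
    case (Suc n)
    then show ?case
      using e[of "(s n, n)"] by (simp add: U_def V_def s_def)
  qed (use E 0 in simp)
  have mono: "\<exists>x y. U (n + k) = U n @ x \<and> V (n + k) = V n @ y" for n k
  proof (induction k)
    case (Suc k)
    then show ?case using US[of "n + k"] by auto
  qed simp
  \<comment> \<open>Entries never change once placed, so entries from two different stages can be
    compared at the later stage.\<close>
  have nth_mono: "U m ! i = U n ! i \<and> V m ! i = V n ! i \<and> i < length (U m)"
    if "n \<le> m" "i < length (U n)" for n m i
    using mono[of n "m - n"] that len[OF EUV[of n]] by (auto simp: nth_append)
  have nth_eq: "U n ! i = U m ! j \<longleftrightarrow> V n ! i = V m ! j"
    if "i < length (U n)" "j < length (U m)" for n m i j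
    using nth_mono[of n "max n m" i] nth_mono[of m "max n m" j] eq[OF EUV[of "max n m"], of i j] that
    by simp
  \<comment> \<open>Stage \<open>n\<close> places \<open>n\<close> at position
    \<open>length (U n)\<close> of the left tuple, so its partner is found there on the right. By
    \<open>nth_eq\<close> any other occurrence of \<open>n\<close> gives the same partner.\<close>
  define g where "g n = V (Suc n) ! length (U n)" for n
  have at: "length (U n) < length (U (Suc n))" "U (Suc n) ! length (U n) = n" for n
    using US[of n] by auto
  have g: "g (U n ! i) = V n ! i" if "i < length (U n)" for n i
    unfolding g_def using nth_eq[OF that at(1)[of "U n ! i"]] at(2) by simp
  have map_g: "map g (U n) = V n" for n
    using g len[OF EUV[of n]] by (auto simp: list_eq_iff_nth_eq)
  have "inj g"
  proof (rule injI)
    fix x y assume "g x = g y"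
    then show "x = y"
      unfolding g_def using nth_eq[OF at(1)[of x] at(1)[of y]] at(2) by simp
  qed
  moreover have "n \<in> range g" for n
  proof -
    have "n \<in> set (V (Suc n))"
      using US[of n] by auto
    then show ?thesis
      unfolding map_g[symmetric] by auto
  qed
  ultimately have "bij g"
    by (auto simp: bij_def)
  moreover have "{..<n} \<subseteq> set (U n)" for n
  proof (induction n)
    case (Suc n)
    with US[of n] show ?case
      by (auto simp: lessThan_Suc)
  qed simp
  moreover have "map g u = v"
    using map_g[of 0] 0 by simp
  moreover have "E (U n) (map g (U n))" for n
    using EUV map_g by simp
  ultimately show ?thesis
    by blast
qed

text \<open>Every atomic fact concerns finitely many numbers, which all lie in some \<open>w\<close>
  that is inseparable from \<open>map g w\<close>. The atomic families carry the fact from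
  \<open>w\<close> to \<open>map g w\<close>.\<close>

lemma inseparable_imp_automorphism:
  assumes N: "N \<in> nat_structures L" and uv: "inseparable L N u v"
  shows "\<exists>g. automorphism L N g \<and> map g u = v"
proof -
  have "\<exists>g. bij g \<and> map g u = v \<and> (\<forall>n. \<exists>w. {..<n} \<subseteq> set w \<and> inseparable L N w (map g w))"
  proof (rule back_and_forth)
    show "length u = length v" if "inseparable L N u v" for u v
      using that by (simp add: inseparable_def)
    show "\<exists>d. inseparable L N (u @ [c]) (v @ [d])" if "inseparable L N u v" for u v c
      using that by (rule inseparable_forth[OF N])
    show "\<exists>c. inseparable L N (u @ [c]) (v @ [d])" if "inseparable L N u v" for u v d
      using inseparable_forth[OF N inseparable_sym[OF that]] inseparable_sym by blast
  qed (fact inseparable_nth_eq[OF N] uv)+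
  then obtain g where g: "bij g" "map g u = v"
    and w: "\<And>n. \<exists>w. {..<n} \<subseteq> set w \<and> inseparable L N w (map g w)"
    by blast
  \<comment> \<open>Writing \<open>xs\<close> by positions in \<open>w\<close> gives the form that
    the atomic families expect. Below, \<open>0 # xs\<close> makes the maximum meaningful for empty
    \<open>xs\<close>, and \<open>Suc\<close> accounts for the strict bound.\<close>
  have cover: "\<exists>w is. inseparable L N w (map g w) \<and> (\<forall>i\<in>set is. i < length w) \<and>
      xs = map ((!) w) is" for xs
  proof -
    obtain w where sub: "{..<Suc (Max (set (0 # xs)))} \<subseteq> set w"
      and E: "inseparable L N w (map g w)"
      using w by blast
    have "x \<in> set w" if "x \<in> set xs" for x
    proof -
      have "x \<le> Max (set (0 # xs))"
        using that by (intro Max_ge) auto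
      then show ?thesis
        using sub by (auto simp del: set_simps)
    qed
    then have "\<exists>i<length w. w ! i = x" if "x \<in> set xs" for x
      using that by (simp add: in_set_conv_nth)
    then obtain k where "\<And>x. x \<in> set xs \<Longrightarrow> k x < length w \<and> w ! k x = x"
      by metis
    then show ?thesis
      using E by (intro exI[of _ w] exI[of _ "map k xs"]) (auto intro!: map_idI[symmetric])
  qed
  have map_nth: "map ((!) (map g w)) is = map g (map ((!) w) is)"
    if "\<forall>i\<in>set is. i < length w" for w "is"
    using that by auto
  have "xs \<in> rel_int N R \<longleftrightarrow> map g xs \<in> rel_int N R"
    if R: "R \<in> rel_syms L" "length xs = rel_arity L R" for R xs
  proof -
    obtain w "is" where *: "inseparable L N w (map g w)" "\<forall>i\<in>set is. i < length w"
      "xs = map ((!) w) is"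
      using cover by blast
    with R have "length is = rel_arity L R" by simp
    from inseparable_iff[OF *(1) invariant_family_rel[OF R(1) this]] show ?thesis
      using * N map_nth[OF *(2)] by (simp del: map_map)
  qed
  moreover have "g (const_int N c) = const_int N c" if c: "c \<in> const_syms L" for c
  proof -
    obtain w "is" where *: "inseparable L N w (map g w)" "\<forall>i\<in>set is. i < length w"
      "[const_int N c] = map ((!) w) is"
      using cover by blast
    then obtain j where j: "j < length w" "const_int N c = w ! j"
      by (cases "is") auto
    from inseparable_iff[OF *(1) invariant_family_const[OF c, of j]] show ?thesis
      using j N by simp
  qed
  moreover have "g (fun_int N f xs) = fun_int N f (map g xs)"
    if f: "f \<in> fun_syms L" "length xs = fun_arity L f" for f xs
  proof -
    \<comment> \<open>The value is covered together with the arguments, so that one tuple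
      \<open>w\<close> serves for both sides of the equation.\<close>
    obtain w js where *: "inseparable L N w (map g w)" "\<forall>i\<in>set js. i < length w"
      "fun_int N f xs # xs = map ((!) w) js"
      using cover by blast
    then obtain j "is" where j: "j < length w" "fun_int N f xs = w ! j"
      and i: "\<forall>i\<in>set is. i < length w" "xs = map ((!) w) is"
      by (cases js) auto
    with f have "length is = fun_arity L f" by simp
    from inseparable_iff[OF *(1) invariant_family_fun[OF f(1) this, of j]] show ?thesis
      using j i N map_nth[OF i(1)] by (simp del: map_map)
  qed
  moreover have univ: "universe N = UNIV"
    using N by (simp add: nat_structures_iff)
  ultimately have "automorphism L N g"
    unfolding automorphism_def isomorphism_def univ tuples_UNIV using g(1) by blast
  with g show ?thesis by blast
qed

text \<open>There are only countably many tuples \<open>v\<close> of the length of \<open>u\<close>,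
  so one separating family for each \<open>v\<close> that is not inseparable from \<open>u\<close>
  can be intersected. What survives in \<open>N\<close> at that length is inseparable from
  \<open>u\<close>, hence in its orbit.\<close>

lemma orbit_family:
  assumes N: "N \<in> nat_structures L"
  obtains P where "invariant_family L P" "N \<in> P u"
    and "\<And>v. length v = length u \<Longrightarrow> N \<in> P v \<Longrightarrow> \<exists>g. automorphism L N g \<and> map g u = v"
proof -
  let ?I = "{v. length v = length u \<and> \<not> inseparable L N u v}"
  have "\<forall>v\<in>?I. \<exists>P. invariant_family L P \<and> N \<in> P u \<and> N \<notin> P v"
  proof
    fix v assume "v \<in> ?I"
    then have "length u = length v" "\<not> inseparable L N u v" by simp_all
    then obtain P where "invariant_family L P" "N \<in> P u" "N \<notin> P v"
      by (rule separating_family[OF N])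
    then show "\<exists>P. invariant_family L P \<and> N \<in> P u \<and> N \<notin> P v" by blast
  qed
  from bchoice[OF this] obtain P where
    P: "\<forall>v\<in>?I. invariant_family L (P v) \<and> N \<in> P v u \<and> N \<notin> P v v" ..
  show thesis
  proof (rule that)
    show "invariant_family L (\<lambda>w. nat_structures L \<inter> (\<Inter>v\<in>?I. P v w))"
    proof (rule invariant_family_INT)
      fix v assume "v \<in> ?I"
      with P show "invariant_family L (P v)" by blast
    qed (rule countableI_type)
    show "N \<in> nat_structures L \<inter> (\<Inter>v\<in>?I. P v u)"
      using N P by (intro IntI INT_I) simp_all
    fix v assume v: "length v = length u" "N \<in> nat_structures L \<inter> (\<Inter>w\<in>?I. P w v)"
    have "inseparable L N u v"
    proof (rule ccontr)
      assume "\<not> inseparable L N u v"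
      with v(1) have I: "v \<in> ?I" by simp
      then have "N \<in> P v v" using v(2) by (simp only: Int_iff INT_iff)
      with P I show False by blast
    qed
    then show "\<exists>g. automorphism L N g \<and> map g u = v"
      by (rule inseparable_imp_automorphism[OF N])
  qed
qed

section \<open>Invariant measures\<close>

text \<open>For positive \<open>c\<close>, enough of the disjoint sets would together outweigh the
  whole space.\<close>

lemma (in finite_measure) disjoint_equal_measure_zero:
  assumes I: "infinite I" and A: "\<And>i. i \<in> I \<Longrightarrow> A i \<in> sets M"
    and disj: "disjoint_family_on A I" and c: "\<And>i. i \<in> I \<Longrightarrow> measure M (A i) = c"
  shows "c = 0"
proof (rule ccontr)
  assume "c \<noteq> 0"
  moreover have "c \<ge> 0"
    using I c measure_nonneg by (metis ex_in_conv finite.emptyI)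
  ultimately have "c > 0" by simp
  then obtain n where n: "measure M (space M) < of_nat n * c"
    using reals_Archimedean3 by blast
  obtain F where F: "finite F" "card F = n" "F \<subseteq> I"
    using infinite_arbitrarily_large[OF I] by blast
  have "of_nat n * c = (\<Sum>i\<in>F. measure M (A i))"
    using F c by (simp add: subset_eq)
  also have "\<dots> = measure M (\<Union>i\<in>F. A i)"
    using F A disjoint_family_on_mono[OF F(3) disj]
    by (intro finite_measure_finite_Union[symmetric]) blast+
  also have "\<dots> \<le> measure M (space M)"
    by (rule bounded_measure)
  finally show False
    using n by simp
qed

text \<open>Isomorphisms between structures on the natural numbers are instances of the action, so
  all copies of \<open>M\<close> form the orbit of any one of them.\<close>

lemma isomorphism_class_eq:
  assumes N0: "N0 \<in> nat_structures L" and h: "isomorphism L N0 M h"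
  shows "{N \<in> nat_structures L. isomorphic L N M} = {logic_action L g N0 | g. bij g}"
proof (intro equalityI subsetI)
  fix N assume "N \<in> {N \<in> nat_structures L. isomorphic L N M}"
  then obtain k where N: "N \<in> nat_structures L" and k: "isomorphism L N M k"
    by (auto simp: isomorphic_def)
  then have "isomorphism L M N (inv_into (universe N) k)"
    by (intro isomorphism_inv_into) (simp_all add: nat_structures_def)
  from isomorphism_comp[OF h this]
  have "bij (inv_into (universe N) k \<circ> h)" "logic_action L (inv_into (universe N) k \<circ> h) N0 = N"
    by (simp_all only: isomorphism_iff_logic_action[OF N0 N])
  then show "N \<in> {logic_action L g N0 | g. bij g}"
    by (metis (mono_tags, lifting) mem_Collect_eq)
next
  fix N assume "N \<in> {logic_action L g N0 | g. bij g}"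
  then obtain g where g: "bij g" "logic_action L g N0 = N" by blast
  then have N: "N \<in> nat_structures L"
    using logic_action_in_nat_structures[OF N0] by blast
  with g have "isomorphism L N0 N g"
    using isomorphism_iff_logic_action[OF N0 N] by blast
  then have "isomorphism L N N0 (inv_into (universe N0) g)"
    using N0 by (intro isomorphism_inv_into) (simp_all add: nat_structures_def)
  from isomorphism_comp[OF this h] N show "N \<in> {N \<in> nat_structures L. isomorphic L N M}"
    by (auto simp: isomorphic_def)
qed

section \<open>Definable closure under an invariant measure\<close>

lemma dcl_subset_of_invariant_measure:
  assumes sets: "sets \<mu> = sets (structure_space L)" and "prob_space \<mu>"
    and inv: "invariant_measure L \<mu>" and N0: "N0 \<in> nat_structures L"
    and one: "emeasure \<mu> {logic_action L g N0 | g. bij g} = 1"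
  shows "dcl L N0 a \<subseteq> set a"
proof
  fix b assume dcl: "b \<in> dcl L N0 a"
  interpret prob_space \<mu> by fact
  let ?O = "{logic_action L g N0 | g. bij g}"
  let ?u = "a @ [b]"
  obtain P where P: "invariant_family L P" "N0 \<in> P ?u"
    and orbit: "\<And>v. length v = length ?u \<Longrightarrow> N0 \<in> P v \<Longrightarrow> \<exists>g. automorphism L N0 g \<and> map g ?u = v"
    using orbit_family[OF N0] by metis
  \<comment> \<open>Since \<open>emeasure\<close> is 0 on non-measurable sets, the value 1 makes the
    orbit measurable.\<close>
  have O: "?O \<in> events"
    using one emeasure_notin_sets by fastforce
  have PO: "P w \<inter> ?O \<in> events" for w
    using O invariant_family_sets[OF P(1)] sets by blast
  \<comment> \<open>Every structure in the orbit realizes the type of \<open>?u\<close> at some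
    tuple. As there are countably many tuples, one of them must do so with positive measure.\<close>
  have "?O = (\<Union>w\<in>{w. length w = length ?u}. P w \<inter> ?O)"
  proof (intro equalityI subsetI)
    fix N assume N: "N \<in> ?O"
    then obtain g where g: "bij g" "N = logic_action L g N0" by blast
    then have "N \<in> P (map g ?u)"
      using invariant_family_iff[OF P(1) g(1) N0] P(2) by blast
    moreover have "length (map g ?u) = length ?u"
      by (rule length_map)
    ultimately show "N \<in> (\<Union>w\<in>{w. length w = length ?u}. P w \<inter> ?O)"
      using N by blast
  qed blast
  moreover have "(\<Union>w\<in>{w. length w = length ?u}. P w \<inter> ?O) \<in> null_sets \<mu>"
    if "\<And>w. length w = length ?u \<Longrightarrow> emeasure \<mu> (P w \<inter> ?O) = 0"
  proof (rule null_sets_UN')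
    show "countable {w :: nat list. length w = length ?u}"
      by (rule countableI_type)
    fix w assume "w \<in> {w :: nat list. length w = length ?u}"
    then show "P w \<inter> ?O \<in> null_sets \<mu>"
      using that PO by (intro null_setsI) simp_all
  qed
  ultimately obtain w where w: "length w = length ?u" "emeasure \<mu> (P w \<inter> ?O) \<noteq> 0"
    using one null_setsD1[of ?O \<mu>] by fastforce
  have AE_O: "emeasure \<mu> (B \<inter> ?O) = emeasure \<mu> B" if B: "B \<in> events" for B
  proof -
    have "AE N in \<mu>. N \<in> ?O"
      using one O by (intro AE_prob_1) (simp add: measure_def)
    then show ?thesis
      using B O by (intro emeasure_eq_AE) auto
  qed
  \<comment> \<open>Some \<open>g\<close> carries \<open>N0\<close> to \<open>N\<close>, but need
    not send \<open>?u\<close> to \<open>v\<close>. The pullback of \<open>v\<close> lies in the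
    orbit of \<open>?u\<close>, so composing with an automorphism \<open>k\<close> of
    \<open>N0\<close> corrects this.\<close>
  have realized: "\<exists>g. bij g \<and> logic_action L g N0 = N \<and> map g ?u = v"
    if "N \<in> P v \<inter> ?O" and len: "length v = length ?u" for N v
  proof -
    from that obtain g where g: "bij g" "logic_action L g N0 = N" by blast
    have "N0 \<in> P (map (inv g) v)"
      using that invariant_family_iff[OF P(1) g(1) N0, of "map (inv g) v"] g map_inv_map[OF g(1)]
      by (simp del: map_map)
    then obtain k where k: "automorphism L N0 k" "map k ?u = map (inv g) v"
      using orbit[of "map (inv g) v"] len by (auto simp del: map_append)
    have N: "N \<in> nat_structures L"
      using g logic_action_in_nat_structures[OF N0] by blast
    have "isomorphism L N0 N (g \<circ> k)"
      using k(1) g isomorphism_iff_logic_action[OF N0 N]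
      by (intro isomorphism_comp) (auto simp: automorphism_def)
    moreover have "map (g \<circ> k) ?u = v"
      using arg_cong[OF k(2), of "map g"] map_inv_map(2)[OF g(1)] by simp
    ultimately show ?thesis
      using isomorphism_iff_logic_action[OF N0 N] by blast
  qed
  show "b \<in> set a"
  proof (rule ccontr)
    assume b: "b \<notin> set a"
    \<comment> \<open>A member of this set exhibits \<open>w\<close> as an image of
      \<open>?u\<close> under a bijection, so the last entry of \<open>w\<close> lies outside the
      rest, just as \<open>b\<close> lies outside \<open>a\<close>.\<close>
    from w(2) have "P w \<inter> ?O \<noteq> {}"
      by (intro notI) (simp only: emeasure_empty)
    then obtain N where "N \<in> P w \<inter> ?O"
      by blast
    from realized[OF this w(1)] obtain g where g: "bij g" "map g ?u = w" by blast
    define m where "m = map g a"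
    have w_eq: "w = m @ [g b]"
      using g(2) by (simp add: m_def)
    have gb: "g b \<notin> set m"
      using b g(1) by (auto simp: m_def bij_def inj_eq)
    \<comment> \<open>Swapping \<open>g b\<close> with \<open>n\<close> fixes \<open>m\<close>, as
      neither number occurs in it, and takes \<open>w\<close> to \<open>m @ [n]\<close>. Invariance
      is applied to \<open>P w\<close> itself; \<open>AE_O\<close> then allows intersecting with the
      orbit.\<close>
    have meas: "measure \<mu> (P (m @ [n]) \<inter> ?O) = measure \<mu> (P w \<inter> ?O)" if n: "n \<in> - set m" for n
    proof -
      have t: "bij (Transposition.transpose (g b) n)" by simp
      have "map (Transposition.transpose (g b) n) m = m"
        using gb n by (auto intro!: map_idI simp: Transposition.transpose_def)
      then have "map (Transposition.transpose (g b) n) w = m @ [n]"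
        by (simp add: w_eq)
      then have "P (m @ [n]) = logic_action L (Transposition.transpose (g b) n) ` P w"
        using invariant_family_image[OF P(1) t, of w] by simp
      moreover have "P w \<in> events"
        using invariant_family_sets[OF P(1)] sets by blast
      ultimately have "emeasure \<mu> (P (m @ [n])) = emeasure \<mu> (P w)"
        using inv t by (simp add: invariant_measure_def)
      then show ?thesis
        using AE_O invariant_family_sets[OF P(1)] sets by (simp add: measure_def)
    qed
    have "measure \<mu> (P w \<inter> ?O) = 0"
    proof (rule disjoint_equal_measure_zero)
      show "infinite (- set m)"
        by (simp add: finite_compl)
      show "disjoint_family_on (\<lambda>n. P (m @ [n]) \<inter> ?O) (- set m)"
      proof (unfold disjoint_family_on_def, intro ballI impI, rule ccontr)
        fix n n' assume "n \<noteq> n'"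
          and "(P (m @ [n]) \<inter> ?O) \<inter> (P (m @ [n']) \<inter> ?O) \<noteq> {}"
        then obtain N where N: "N \<in> P (m @ [n]) \<inter> ?O" "N \<in> P (m @ [n']) \<inter> ?O" by blast
        have len: "length (m @ [x]) = length ?u" for x
          by (simp add: m_def)
        obtain h where h: "bij h" "logic_action L h N0 = N" "map h ?u = m @ [n]"
          using realized[OF N(1) len] by blast
        obtain k where k: "bij k" "logic_action L k N0 = N" "map k ?u = m @ [n']"
          using realized[OF N(2) len] by blast
        have NX: "N \<in> nat_structures L"
          using h logic_action_in_nat_structures[OF N0] by blast
        have iso: "isomorphism L N0 N h" "isomorphism L N0 N k"
          using h k isomorphism_iff_logic_action[OF N0 NX] by blast+
        have "isomorphism L N N0 (inv k)"
          using isomorphism_inv_into[OF _ iso(2)] N0 by (simp add: nat_structures_def)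
        \<comment> \<open>Both \<open>h\<close> and \<open>k\<close> carry \<open>N0\<close> to
          \<open>N\<close> and agree on \<open>a\<close>, so they differ by an automorphism of
          \<open>N0\<close> over \<open>a\<close>. It must fix \<open>b\<close>, which forces
          \<open>n = n'\<close>.\<close>
        then have "automorphism L N0 (inv k \<circ> h)"
          unfolding automorphism_def by (rule isomorphism_comp[OF iso(1)])
        moreover have "\<forall>x\<in>set a. (inv k \<circ> h) x = x"
        proof -
          have "map h a = map k a"
            using h k by simp
          then show ?thesis
            using k(1) by (auto simp: bij_is_inj)
        qed
        ultimately have "inv k (h b) = b"
          using dcl by (auto simp: dcl_def)
        then have "h b = k b"
          using k(1) by (metis bij_inv_eq_iff)
        with h k \<open>n \<noteq> n'\<close> show False by simp
      qed
    qed (use meas PO in auto)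
    with w(2) show False
      by (simp add: emeasure_eq_measure)
  qed
qed

section \<open>Transfer between isomorphic structures\<close>

text \<open>An automorphism \<open>f\<close> of \<open>N\<close> fixing \<open>a\<close> is
  conjugated by \<open>h\<close> to an automorphism of \<open>M\<close> fixing
  \<open>map h a\<close>. The latter fixes \<open>h b\<close>, and injectivity of \<open>h\<close>
  gives \<open>f b = b\<close>.\<close>

lemma dcl_isomorphism:
  assumes h: "isomorphism L N M h" and N: "is_structure L N"
    and a: "set a \<subseteq> universe N" and b: "b \<in> universe N" and dcl: "h b \<in> dcl L M (map h a)"
  shows "b \<in> dcl L N a"
proof -
  have bij: "bij_betw h (universe N) (universe M)"
    using h by (simp add: isomorphism_def)
  let ?k = "inv_into (universe N) h"
  have k: "?k (h x) = x" if "x \<in> universe N" for x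
    using that bij by (simp add: bij_betw_inv_into_left)
  have "f b = b" if f: "automorphism L N f" "\<forall>x\<in>set a. f x = x" for f
  proof -
    have "isomorphism L M M ((h \<circ> f) \<circ> ?k)"
      using isomorphism_comp[OF isomorphism_inv_into[OF N h]
          isomorphism_comp[OF f(1)[unfolded automorphism_def] h]] .
    moreover have "\<forall>y\<in>set (map h a). ((h \<circ> f) \<circ> ?k) y = y"
      using f(2) a k by auto
    ultimately have "((h \<circ> f) \<circ> ?k) (h b) = h b"
      using dcl by (auto simp: dcl_def automorphism_def)
    then have "h (f b) = h b"
      using k b by simp
    moreover have "f b \<in> universe N"
      using f(1) b by (auto simp: automorphism_def isomorphism_def bij_betw_def)
    ultimately show ?thesis
      using bij b by (auto simp: bij_betw_def inj_on_def)
  qed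
  with b show ?thesis
    by (auto simp: dcl_def)
qed

theorem theorem5p1:
  fixes L :: "('r, 'c, 'f) language"
    and M :: "('a, 'r, 'c, 'f) lstructure"
  assumes "countable_language L"
    and "is_structure L M" and "countable (universe M)" and "infinite (universe M)"
    and "\<exists>\<mu>. sets \<mu> = sets (structure_space L) \<and> prob_space \<mu> \<and>
              invariant_measure L \<mu> \<and> concentrated_on L \<mu> M"
  shows "trivial_dcl L M"
proof -
  obtain \<mu> where \<mu>: "sets \<mu> = sets (structure_space L)" "prob_space \<mu>" "invariant_measure L \<mu>"
    and one: "emeasure \<mu> {N \<in> nat_structures L. isomorphic L N M} = 1"
    using assms(5) by (auto simp: concentrated_on_def)
  \<comment> \<open>A set of measure 1 is nonempty, which supplies a copy \<open>N\<close> of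
    \<open>M\<close> on the natural numbers.\<close>
  from one have "{N \<in> nat_structures L. isomorphic L N M} \<noteq> {}"
    by (metis emeasure_empty zero_neq_one)
  then obtain N h where N: "N \<in> nat_structures L" and h: "isomorphism L N M h"
    by (auto simp: isomorphic_def)
  have bij: "bij_betw h UNIV (universe M)"
    using h N by (simp add: isomorphism_def nat_structures_iff)
  have "b \<in> set a" if a: "set a \<subseteq> universe M" and b: "b \<in> dcl L M a" for a b
  proof -
    let ?k = "inv_into UNIV h"
    have k: "h (?k x) = x" if "x \<in> universe M" for x
      using that bij by (simp add: bij_betw_inv_into_right)
    have map_k: "map h (map ?k a) = a"
      using a k by (auto intro!: map_idI)
    have "h (?k b) = b"
      using k b by (simp add: dcl_def)
    with b map_k have "?k b \<in> dcl L N (map ?k a)"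
      using N by (intro dcl_isomorphism[OF h]) (simp_all add: nat_structures_def)
    moreover have "emeasure \<mu> {logic_action L g N | g. bij g} = 1"
      using one isomorphism_class_eq[OF N h] by simp
    ultimately have "?k b \<in> set (map ?k a)"
      using dcl_subset_of_invariant_measure[OF \<mu> N] by blast
    then show ?thesis
      using \<open>h (?k b) = b\<close> map_k by (metis image_eqI list.set_map)
  qed
  \<comment> \<open>The reverse inclusion is immediate, since the automorphisms considered fix the
    entries of \<open>a\<close>.\<close>
  then show ?thesis
    by (auto simp: trivial_dcl_def dcl_def)
qed

end
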